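(* Let $\alpha\in(0,1/2)$, and let the experiment ($X$, $Y$, $\theta$, $Z$, $p$, $P$, $\mathcal{E}$) be as in the context, with $0\le\theta_i\le Y_i$ for $i=1,\ldots,N$. Consider a realization with $L=\sum_{i=1}^N Z_i>0$. Put $$\hat\theta_Y=\frac1L\sum_{i=1}^N Y_iZ_i,\qquad \tilde\sigma_Y=Np(1-p)\Big(\frac1L\sum_{i=1}^N (Y_i-\hat\theta_Y)^2Z_i\Big)+\sum_{i=1}^N\sum_{j=1}^N Y_iY_j\frac{\max(\mathcal{E}_{ij},0)}{P_{ij}}Z_iZ_j,$$ and suppose $\tilde\sigma_Y>0$. If $$1-z_{1-\alpha}\frac{\hat\theta_Y}{\sqrt{\tilde\sigma_Y}}\cdot\frac{2Np(1-p)}{L}\ge 0,$$ then $\vartheta=Y$ is a maximizer of the optimization problem $$\max_{\vartheta\in\mathbb{R}^N}\ \hat\theta(\vartheta)+z_{1-\alpha}\frac{\sqrt{\tilde\sigma(\vartheta)}}{L}\quad\text{subject to}\quad 0\le\vartheta_i\le Y_i,\ i=1,\ldots,N,$$ and consequently $$\mathrm{CI}^{\mathrm{obs}}=\hat\theta_Y+z_{1-\alpha}\frac{\sqrt{\tilde\sigma_Y}}{L}$$ is an upper bound for $\mathrm{CI}^{\mathrm{ideal}}=\hat\theta(\theta)+z_{1-\alpha}\frac{\sqrt{\hat\sigma(\theta)}}{L}$ (whenever $\hat\sigma(\theta)\ge0$, so that the latter is defined).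
   Context: Setting. $X=(X_1,\ldots,X_N)$ are i.i.d. $\mathrm{Bernoulli}(\rho)$ treatments; outcomes are $Y_i=f_i(X_1,\ldots,X_N)$ for arbitrary fixed functions $f_i:\{0,1\}^N\to\mathbb{R}$; $\theta_i=f_i(1,\ldots,1)$ is the counterfactual outcome under full treatment. For each $i$, $\eta_i\subset\{1,\ldots,N\}$ is a fixed set containing $i$ and $h_i$ is a fixed $\{0,1\}$-valued function; $Z_i=h_i(\{X_j:j\in\eta_i\})$. It is assumed that $\mathbb{P}(Z_i=1)=p$ for all $i$ and that $P_{ij}:=\mathbb{P}(Z_iZ_j=1)\ge p_{\min}>0$ for all $i,j$. Let $I$ be the $N\times N$ identity, $\mathbf{1}$ the all-ones vector, $P=(P_{ij})$, and $$R=P-p(1-p)I-p^2\mathbf{1}\mathbf{1}^T,\qquad \mathcal{E}=\Big(I-\frac{\mathbf{1}\mathbf{1}^T}{N}\Big)^T R\Big(I-\frac{\mathbf{1}\mathbf{1}^T}{N}\Big).$$ For $\vartheta\in\mathbb{R}^N$ (with $Z$ fixed, $L=\sum_i Z_i>0$) define $$\hat\theta(\vartheta)=\frac1L\sum_{i=1}^N\vartheta_iZ_i,$$ $$\hat\sigma(\vartheta)=Np(1-p)\Big(\frac1L\sum_{i=1}^N(\vartheta_i-\hat\theta(\vartheta))^2Z_i\Big)+\sum_{i=1}^N\sum_{j=1}^N\vartheta_i\vartheta_j\frac{\mathcal{E}_{ij}}{P_{ij}}Z_iZ_j,$$ $$\tilde\sigma(\vartheta)=Np(1-p)\Big(\frac1L\sum_{i=1}^N(\vartheta_i-\hat\theta(\vartheta))^2Z_i\Big)+\sum_{i=1}^N\sum_{j=1}^N\vartheta_i\vartheta_j\frac{\max(\mathcal{E}_{ij},0)}{P_{ij}}Z_iZ_j.$$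 $z_{1-\alpha}$ is the $(1-\alpha)$ quantile of the standard normal distribution. The statement is a deterministic one for each realization. *)

theory Defs
  imports "HOL-Probability.Probability"
begin

(* Units are the elements of a finite type 'n, so N = CARD('n).  A treatment vector in
   {0,1}^N is a function 'n => bool, with True for "treated". *)

definition outcome :: "('n::finite \<Rightarrow> ('n \<Rightarrow> bool) \<Rightarrow> real) \<Rightarrow> ('n \<Rightarrow> 'w \<Rightarrow> bool) \<Rightarrow> 'w \<Rightarrow> real ^ 'n" where
  "outcome f X \<omega> = (\<chi> i. f i (\<lambda>j. X j \<omega>))"

definition full_treatment_outcome :: "('n::finite \<Rightarrow> ('n \<Rightarrow> bool) \<Rightarrow> real) \<Rightarrow> real ^ 'n" where
  "full_treatment_outcome f = (\<chi> i. f i (\<lambda>j. True))"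

(* The restriction makes the i-th exposure a function of the treatments in \<eta> i only. *)
definition exposure ::
  "('n::finite \<Rightarrow> 'n set) \<Rightarrow> ('n \<Rightarrow> ('n \<Rightarrow> bool) \<Rightarrow> bool) \<Rightarrow> ('n \<Rightarrow> 'w \<Rightarrow> bool) \<Rightarrow> 'w \<Rightarrow> real ^ 'n" where
  "exposure \<eta> h X \<omega> = (\<chi> i. of_bool (h i (restrict (\<lambda>j. X j \<omega>) (\<eta> i))))"

definition joint_exposure_prob :: "'w measure \<Rightarrow> ('w \<Rightarrow> real ^ 'n) \<Rightarrow> real ^ 'n ^ 'n::finite" where
  "joint_exposure_prob M Z = (\<chi> i j. measure M {\<omega> \<in> space M. Z \<omega> $ i * Z \<omega> $ j = 1})"

(* The matrix 1 1^T. *)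
definition ones_matrix :: "real ^ 'n ^ 'n::finite" where
  "ones_matrix = (\<chi> i j. 1)"

definition R_matrix :: "real \<Rightarrow> real ^ 'n ^ 'n \<Rightarrow> real ^ 'n ^ 'n::finite" where
  "R_matrix p P = P - (p * (1 - p)) *\<^sub>R mat 1 - p\<^sup>2 *\<^sub>R ones_matrix"

definition centering_matrix :: "real ^ 'n ^ 'n::finite" where
  "centering_matrix = mat 1 - (1 / real CARD('n)) *\<^sub>R ones_matrix"

definition E_matrix :: "real \<Rightarrow> real ^ 'n ^ 'n \<Rightarrow> real ^ 'n ^ 'n::finite" where
  "E_matrix p P = transpose centering_matrix ** R_matrix p P ** centering_matrix"

(* In the estimators below, z is the realized exposure vector and v the vector of outcomes. *)

definition num_exposed :: "real ^ 'n::finite \<Rightarrow> real" where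
  "num_exposed z = (\<Sum>i\<in>UNIV. z $ i)"

definition theta_hat :: "real ^ 'n::finite \<Rightarrow> real ^ 'n \<Rightarrow> real" where
  "theta_hat z v = 1 / num_exposed z * (\<Sum>i\<in>UNIV. v $ i * z $ i)"

definition sigma_hat :: "real \<Rightarrow> real ^ 'n ^ 'n \<Rightarrow> real ^ 'n::finite \<Rightarrow> real ^ 'n \<Rightarrow> real" where
  "sigma_hat p P z v =
     real CARD('n) * p * (1 - p) *
       (1 / num_exposed z * (\<Sum>i\<in>UNIV. (v $ i - theta_hat z v)\<^sup>2 * z $ i)) +
     (\<Sum>i\<in>UNIV. \<Sum>j\<in>UNIV. v $ i * v $ j * (E_matrix p P $ i $ j / P $ i $ j) * z $ i * z $ j)"

definition sigma_tilde :: "real \<Rightarrow> real ^ 'n ^ 'n \<Rightarrow> real ^ 'n::finite \<Rightarrow> real ^ 'n \<Rightarrow> real" where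
  "sigma_tilde p P z v =
     real CARD('n) * p * (1 - p) *
       (1 / num_exposed z * (\<Sum>i\<in>UNIV. (v $ i - theta_hat z v)\<^sup>2 * z $ i)) +
     (\<Sum>i\<in>UNIV. \<Sum>j\<in>UNIV. v $ i * v $ j * (max (E_matrix p P $ i $ j) 0 / P $ i $ j) * z $ i * z $ j)"

(* Meaningful for 0 < q < 1, where the set is nonempty and bounded below. *)
definition std_normal_quantile :: "real \<Rightarrow> real" where
  "std_normal_quantile q = Inf {x. q \<le> cdf std_normal_distribution x}"

end

theory Submission
  imports Defs
begin

text \<open>
  Let \<open>c = N p (1 - p)\<close>, and write \<open>\<theta>\<close>, \<open>\<sigma>\<close> for the estimators \<open>theta_hat\<close>, \<open>sigma_tilde\<close>. Then \<open>\<sigma>(v)\<close>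
  equals \<open>c ((1/L) \<Sum> v\<^sub>i\<^sup>2 Z\<^sub>i - \<theta>(v)\<^sup>2)\<close> plus a quadratic form with nonnegative coefficients. For
  \<open>0 \<le> v \<le> Y\<close>, passing from \<open>v\<close> to \<open>Y\<close> increases every term except \<open>-c \<theta>(v)\<^sup>2\<close>, so
  \<open>\<sigma>(v) - \<sigma>(Y) \<le> c (\<theta>(Y)\<^sup>2 - \<theta>(v)\<^sup>2) \<le> 2 c \<theta>(Y) (\<theta>(Y) - \<theta>(v))\<close>.
  If \<open>\<sigma>(v) \<le> \<sigma>(Y)\<close> the claim is monotonicity of \<open>\<theta>\<close>; otherwise bound \<open>sqrt (\<sigma>(v))\<close> by the tangent of
  the square root at \<open>\<sigma>(Y)\<close>, where the hypothesis on \<open>Y\<close> alone suffices.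
\<close>

text \<open>Symmetry of the standard normal law: the affine map with slope -1 and shift 0 keeps mean
  0 and deviation 1.\<close>

lemma std_normal_distribution_uminus:
  "distr std_normal_distribution borel uminus = std_normal_distribution"
proof -
  interpret prob_space std_normal_distribution
    by (rule prob_space_normal_density) simp
  have "distributed std_normal_distribution lborel (\<lambda>x. x) std_normal_density"
    by (auto simp: distributed_def distr_id2)
  from normal_density_affine[OF this, of "-1" 0]
  have "distributed std_normal_distribution lborel uminus std_normal_density"
    by simp
  then have "distr std_normal_distribution lborel uminus = std_normal_distribution"
    by (simp add: distributed_def)
  then show ?thesis
    by (metis distr_cong sets_lborel)
qed

text \<open>By symmetry the tails \<open>{..x}\<close> and \<open>{-x..}\<close> have equal mass,
  and for negative \<open>x\<close> they are disjoint, so twice that mass is at most 1.\<close>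

lemma cdf_std_normal_le_half:
  assumes "x < 0"
  shows "cdf std_normal_distribution x \<le> 1 / 2"
proof -
  interpret prob_space std_normal_distribution
    by (rule prob_space_normal_density) simp
  have "prob {..x} = measure (distr std_normal_distribution borel uminus) {..x}"
    by (simp only: std_normal_distribution_uminus)
  also have "\<dots> = prob (uminus -` {..x} \<inter> space std_normal_distribution)"
    by (rule measure_distr) auto
  also have "uminus -` {..x} \<inter> space std_normal_distribution = {-x..}"
    by auto
  finally have "prob {..x} = prob {-x..}" .
  moreover have "prob {..x} + prob {-x..} = prob ({..x} \<union> {-x..})"
    using assms by (intro finite_measure_Union[symmetric]) auto
  moreover have "prob ({..x} \<union> {-x..}) \<le> 1"
    by (rule prob_le_1)
  ultimately show ?thesis
    unfolding cdf_def by linarith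
qed

text \<open>Fixes the sign of the multiplier: at a negative point the cdf is at most 1/2, hence
  below \<open>q\<close>, so the set defining the quantile contains no negative number.\<close>

lemma std_normal_quantile_nonneg:
  assumes "1 / 2 < q" "q < 1"
  shows "0 \<le> std_normal_quantile q"
  unfolding std_normal_quantile_def
proof (rule cInf_greatest)
  interpret real_distribution std_normal_distribution
    by (rule real_dist_normal_dist)
  \<comment> \<open>The infimum is only meaningful on a nonempty set; since the cdf tends to 1 >
    \<open>q\<close>, the set is nonempty.\<close>
  have "eventually (\<lambda>x. q < cdf std_normal_distribution x) at_top"
    using cdf_lim_at_top_prob assms(2) by (rule order_tendstoD)
  then have "\<exists>x. q < cdf std_normal_distribution x"
    by (auto simp: eventually_at_top_linorder)
  then show "{x. q \<le> cdf std_normal_distribution x} \<noteq> {}"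
    using less_imp_le by blast
next
  fix x
  assume "x \<in> {x. q \<le> cdf std_normal_distribution x}"
  then show "0 \<le> x"
    using cdf_std_normal_le_half[of x] assms(1) by force
qed

lemma weighted_variance_eq:
  assumes "num_exposed z \<noteq> 0"
  shows "1 / num_exposed z * (\<Sum>i\<in>UNIV. (v $ i - theta_hat z v)\<^sup>2 * z $ i) =
    1 / num_exposed z * (\<Sum>i\<in>UNIV. (v $ i)\<^sup>2 * z $ i) - (theta_hat z v)\<^sup>2"
proof -
  define t L where "t = theta_hat z v" and "L = num_exposed z"
  have L: "L \<noteq> 0" and tL: "(\<Sum>i\<in>UNIV. v $ i * z $ i) = t * L"
    using assms by (simp_all add: t_def L_def theta_hat_def)
  have "(\<Sum>i\<in>UNIV. (v $ i - t)\<^sup>2 * z $ i) =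
      (\<Sum>i\<in>UNIV. (v $ i)\<^sup>2 * z $ i - 2 * t * (v $ i * z $ i) + t\<^sup>2 * z $ i)"
    by (rule sum.cong) (simp_all add: power2_eq_square algebra_simps)
  also have "\<dots> = (\<Sum>i\<in>UNIV. (v $ i)\<^sup>2 * z $ i) - 2 * t * (t * L) + t\<^sup>2 * L"
    by (simp add: sum.distrib sum_subtractf flip: sum_distrib_left tL)
       (simp add: L_def num_exposed_def)
  finally show ?thesis
    using L by (simp add: t_def[symmetric] L_def[symmetric] field_simps power2_eq_square)
qed

lemma theta_hat_mono:
  assumes "\<And>i. 0 \<le> z $ i" "0 < num_exposed z" "\<And>i. v $ i \<le> w $ i"
  shows "theta_hat z v \<le> theta_hat z w"
  unfolding theta_hat_def using assms
  by (intro mult_left_mono sum_mono mult_right_mono) auto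

text \<open>The factor multiplying the gain in \<open>theta_hat\<close> is made to depend on
  \<open>w\<close> alone, since the condition in the theorem is imposed only at
  \<open>Y\<close>.\<close>

lemma sigma_tilde_diff_le:
  fixes z v w :: "real ^ 'n::finite"
  assumes z: "\<And>i. 0 \<le> z $ i" "0 < num_exposed z"
    and v: "\<And>i. 0 \<le> v $ i" "\<And>i. v $ i \<le> w $ i"
    and p: "0 \<le> p" "p \<le> 1" and P: "\<And>i j. 0 \<le> P $ i $ j"
  shows "sigma_tilde p P z v - sigma_tilde p P z w
    \<le> 2 * (real CARD('n) * p * (1 - p)) * theta_hat z w * (theta_hat z w - theta_hat z v)"
proof -
  define c where "c = real CARD('n) * p * (1 - p)"
  define S :: "real ^ 'n \<Rightarrow> real" where "S u = 1 / num_exposed z * (\<Sum>i\<in>UNIV. (u $ i)\<^sup>2 * z $ i)" for u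
  define Q :: "real ^ 'n \<Rightarrow> real" where
    "Q u = (\<Sum>i\<in>UNIV. \<Sum>j\<in>UNIV. u $ i * u $ j * (max (E_matrix p P $ i $ j) 0 / P $ i $ j) * z $ i * z $ j)"
    for u
  have sigma: "sigma_tilde p P z u = c * (S u - (theta_hat z u)\<^sup>2) + Q u" for u
    unfolding sigma_tilde_def c_def S_def Q_def using z(2) by (subst weighted_variance_eq) simp_all
  have c: "0 \<le> c"
    using p by (simp add: c_def)
  have "S v \<le> S w"
    unfolding S_def using z v
    by (intro mult_left_mono sum_mono mult_right_mono power_mono) auto
  moreover have "Q v \<le> Q w"
    unfolding Q_def using z v P order_trans[OF v]
    by (intro sum_mono mult_right_mono mult_mono divide_nonneg_nonneg) auto
  \<comment> \<open>The right side exceeds the left by exactly the square of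
    \<open>theta_hat z w - theta_hat z v\<close>.\<close>
  moreover have "(theta_hat z w)\<^sup>2 - (theta_hat z v)\<^sup>2
      \<le> 2 * theta_hat z w * (theta_hat z w - theta_hat z v)"
    using sum_power2_ge_zero[of "theta_hat z w - theta_hat z v" 0]
    by (simp add: power2_eq_square algebra_simps)
  ultimately have "c * (S v - (theta_hat z v)\<^sup>2 - (S w - (theta_hat z w)\<^sup>2))
      \<le> c * (2 * theta_hat z w * (theta_hat z w - theta_hat z v))" and "Q v \<le> Q w"
    using c by (auto intro: mult_left_mono)
  then show ?thesis
    unfolding sigma c_def[symmetric] by (simp add: algebra_simps)
qed

text \<open>The tangent at \<open>b\<close> lies above the concave square root; the gap is the
  square of \<open>sqrt a - sqrt b\<close> divided by \<open>2 * sqrt b\<close>.\<close>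

lemma sqrt_diff_le:
  assumes "0 \<le> a" "0 < b"
  shows "sqrt a - sqrt b \<le> (a - b) / (2 * sqrt b)"
proof -
  have "(sqrt a - sqrt b) * (2 * sqrt b) = (sqrt a)\<^sup>2 - (sqrt b)\<^sup>2 - (sqrt a - sqrt b)\<^sup>2"
    by algebra
  also have "\<dots> \<le> a - b"
    using assms by simp
  finally have "(sqrt a - sqrt b) * (2 * sqrt b) \<le> a - b" .
  then show ?thesis
    using assms(2) by (simp add: pos_le_divide_eq)
qed

lemma upper_limit_mono:
  fixes z v w :: "real ^ 'n::finite"
  assumes z: "\<And>i. 0 \<le> z $ i" and L: "0 < num_exposed z"
    and v: "\<And>i. 0 \<le> v $ i" "\<And>i. v $ i \<le> w $ i"
    and p: "0 \<le> p" "p \<le> 1" and P: "\<And>i j. 0 \<le> P $ i $ j"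
    and q: "0 \<le> q" and pos: "0 < sigma_tilde p P z w"
    and cond: "q * (theta_hat z w / sqrt (sigma_tilde p P z w)) *
      (2 * real CARD('n) * p * (1 - p) / num_exposed z) \<le> 1"
  shows "theta_hat z v + q * (sqrt (sigma_tilde p P z v) / num_exposed z)
    \<le> theta_hat z w + q * (sqrt (sigma_tilde p P z w) / num_exposed z)"
proof -
  define a b d t L c where "a = sigma_tilde p P z v" and "b = sigma_tilde p P z w"
    and "d = theta_hat z w - theta_hat z v" and "t = theta_hat z w" and "L = num_exposed z"
    and "c = real CARD('n) * p * (1 - p)"
  note defs = a_def b_def d_def t_def L_def c_def
  have d: "0 \<le> d"
    using theta_hat_mono[OF z L v(2)] by (simp add: d_def)
  have L': "0 < L" and b: "0 < b"
    using L pos by (simp_all add: L_def b_def)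
  \<comment> \<open>The claim rearranged: whatever the square root term loses from \<open>v\<close>
    to \<open>w\<close> is paid for by the gain \<open>d\<close> in
    \<open>theta_hat\<close>.\<close>
  have "q / L * (sqrt a - sqrt b) \<le> d"
  proof (cases "a \<le> b")
    case True
    then have "q / L * (sqrt a - sqrt b) \<le> 0"
      using q L' by (intro mult_nonneg_nonpos) auto
    then show ?thesis
      using d by simp
  next
    case False
    have "sqrt a - sqrt b \<le> (a - b) / (2 * sqrt b)"
      using False b by (intro sqrt_diff_le) auto
    also have "\<dots> \<le> (2 * c * t * d) / (2 * sqrt b)"
      using sigma_tilde_diff_le[where P = P, OF z L v p P] b
      by (intro divide_right_mono) (simp_all add: defs)
    finally have "q / L * (sqrt a - sqrt b) \<le> q / L * ((2 * c * t * d) / (2 * sqrt b))"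
      using q L' by (intro mult_left_mono) auto
    \<comment> \<open>Regrouped so that the left side of \<open>cond\<close> appears as a factor;
      the 1/2 is that of the tangent slope.\<close>
    also have "\<dots> = (q * (t / sqrt b) * (2 * c / L)) * (d / 2)"
      by (simp add: field_simps)
    also have "\<dots> \<le> 1 * (d / 2)"
      using cond d by (intro mult_right_mono) (simp_all add: defs mult.assoc)
    finally show ?thesis
      using d by linarith
  qed
  then show ?thesis
    by (simp add: defs algebra_simps diff_divide_distrib)
qed

lemma sigma_hat_le_sigma_tilde:
  assumes "\<And>i. 0 \<le> z $ i" "\<And>i. 0 \<le> v $ i" "\<And>i j. 0 \<le> P $ i $ j"
  shows "sigma_hat p P z v \<le> sigma_tilde p P z v"
  unfolding sigma_hat_def sigma_tilde_def using assms
  by (intro add_left_mono sum_mono mult_right_mono mult_left_mono divide_right_mono) auto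

theorem theorem2:
  fixes M :: "'w measure"
    and X :: "'n::finite \<Rightarrow> 'w \<Rightarrow> bool"
    and f :: "'n \<Rightarrow> ('n \<Rightarrow> bool) \<Rightarrow> real"
    and \<eta> :: "'n \<Rightarrow> 'n set"
    and h :: "'n \<Rightarrow> ('n \<Rightarrow> bool) \<Rightarrow> bool"
    and \<rho> p p_min \<alpha> z\<^sub>\<alpha> L \<theta>Y \<sigma>Y :: real
    and P :: "real ^ 'n ^ 'n"
    and \<theta> Y Z :: "real ^ 'n"
    and \<omega> :: 'w
  assumes "prob_space M"
    and "0 \<le> \<rho>" "\<rho> \<le> 1"
    and "prob_space.indep_vars M (\<lambda>_. count_space UNIV) X UNIV"
    and "\<forall>i. distr M (count_space UNIV) (X i) = measure_pmf (bernoulli_pmf \<rho>)"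
    and "\<forall>i. i \<in> \<eta> i"
    and "\<forall>i. measure M {w \<in> space M. exposure \<eta> h X w $ i = 1} = p"
    and "P = joint_exposure_prob M (exposure \<eta> h X)"
    and "0 < p_min" "\<forall>i j. p_min \<le> P $ i $ j"
    and "0 < \<alpha>" "\<alpha> < 1 / 2"
    and "z\<^sub>\<alpha> = std_normal_quantile (1 - \<alpha>)"
    and "\<theta> = full_treatment_outcome f"
    and "\<omega> \<in> space M"
    and "Y = outcome f X \<omega>"
    and "Z = exposure \<eta> h X \<omega>"
    and "\<forall>i. 0 \<le> \<theta> $ i \<and> \<theta> $ i \<le> Y $ i"
    and "L = num_exposed Z" "0 < L"
    and "\<theta>Y = theta_hat Z Y"
    and "\<sigma>Y = sigma_tilde p P Z Y" "0 < \<sigma>Y"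
    and "1 - z\<^sub>\<alpha> * (\<theta>Y / sqrt \<sigma>Y) * (2 * real CARD('n) * p * (1 - p) / L) \<ge> 0"
  shows "is_arg_max (\<lambda>v. theta_hat Z v + z\<^sub>\<alpha> * (sqrt (sigma_tilde p P Z v) / L))
           (\<lambda>v. \<forall>i. 0 \<le> v $ i \<and> v $ i \<le> Y $ i) Y
       \<and> (0 \<le> sigma_hat p P Z \<theta> \<longrightarrow>
            theta_hat Z \<theta> + z\<^sub>\<alpha> * (sqrt (sigma_hat p P Z \<theta>) / L)
              \<le> \<theta>Y + z\<^sub>\<alpha> * (sqrt \<sigma>Y / L))"
proof -
  interpret prob_space M by fact
  have p: "0 \<le> p" "p \<le> 1"
    using assms(7) by (metis measure_nonneg, metis prob_le_1)
  have P: "0 \<le> P $ i $ j" for i j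
    using assms(9,10) by (meson less_imp_le order_trans)
  have Z: "0 \<le> Z $ i" for i
    by (simp add: assms(17) exposure_def)
  have q: "0 \<le> z\<^sub>\<alpha>"
    unfolding assms(13) using assms(11,12) by (intro std_normal_quantile_nonneg) auto
  have L: "0 < num_exposed Z"
    using assms(19,20) by simp
  have \<theta>: "0 \<le> \<theta> $ i" "\<theta> $ i \<le> Y $ i" for i
    using assms(18) by auto
  have max: "theta_hat Z v + z\<^sub>\<alpha> * (sqrt (sigma_tilde p P Z v) / L)
      \<le> theta_hat Z Y + z\<^sub>\<alpha> * (sqrt (sigma_tilde p P Z Y) / L)"
    if "\<And>i. 0 \<le> v $ i" "\<And>i. v $ i \<le> Y $ i" for v
    unfolding assms(19) using assms(19,21-24) that
    by (intro upper_limit_mono Z L p P q) auto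
  \<comment> \<open>The ideal limit is first raised by replacing \<open>sigma_hat\<close> with
    \<open>sigma_tilde\<close>; then \<open>max\<close> applies, as \<theta> is feasible.\<close>
  have "theta_hat Z \<theta> + z\<^sub>\<alpha> * (sqrt (sigma_hat p P Z \<theta>) / L)
      \<le> theta_hat Z \<theta> + z\<^sub>\<alpha> * (sqrt (sigma_tilde p P Z \<theta>) / L)"
    using sigma_hat_le_sigma_tilde[OF Z \<theta>(1) P] q assms(20)
    by (intro add_left_mono mult_left_mono divide_right_mono) auto
  also note max[OF \<theta>]
  finally have "theta_hat Z \<theta> + z\<^sub>\<alpha> * (sqrt (sigma_hat p P Z \<theta>) / L)
      \<le> \<theta>Y + z\<^sub>\<alpha> * (sqrt \<sigma>Y / L)"
    by (simp add: assms(21,22))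
  \<comment> \<open>A maximizer must itself be feasible, so \<open>Y\<close> has to be
    nonnegative.\<close>
  moreover have "0 \<le> Y $ i" for i
    using \<theta> order_trans by blast
  ultimately show ?thesis
    using max by (auto simp: is_arg_max_def not_less)
qed

end
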